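(* Let $\mathbb{X}$, $\mathbb{Y}$ and $\mathbb{W}$ be quasi-Banach spaces whose quasi-norms have constants $C_{\mathbb{X}}$, $C_{\mathbb{Y}}$ and $C_{\mathbb{W}}$, and let $T\in\mathcal{L}(\mathbb{X},\mathbb{Y})$. Then the Kolmogorov numbers $d_n$ have the following properties. (M$_d$) $\Vert T\Vert=d_{1}(T)\geq d_{2}(T)\geq\ldots\geq0$. (A$_d$) If $S\in\mathcal{L}(\mathbb{X},\mathbb{Y})$ and $n,m\in\mathbb{N}$, then $$d_{m+n-1}(S+T)\leq C_{\mathbb{Y}}\left(d_{m}(S)+d_{n}(T)\right);$$ correspondingly, when the quasi-norm of $\mathbb{Y}$ is replaced by an equivalent $\varrho$-norm with $\varrho\in(0,1]$ (and the Kolmogorov numbers are taken with respect to it), $d_{m+n-1}(S+T)^{\varrho}\leq d_{m}(S)^{\varrho}+d_{n}(T)^{\varrho}$. (P$_d$) If $S\in\mathcal{L}(\mathbb{Y},\mathbb{W})$ and $n,m\in\mathbb{N}$, then $d_{m+n-1}(ST)\leq d_{m}(S)\,d_{n}(T)$. (R$_d$) If $n\in\mathbb{N}$ and $\operatorname{rank}T<n$, then $d_{n}(T)=0$. (N$_d$) If $n\in\mathbb{N}$ and $\dim\mathbb{X}\geq n$, then $d_{n}(\mathrm{id}_{\mathbb{X}})=1$, where $\mathrm{id}_{\mathbb{X}}:\mathbb{X}\to\mathbb{X}$ is the identity. (C$_d$) $T$ is compact if and only if $\lim_{n\rightarrow\infty}d_{n}(T)=0$.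
   Context: Vector spaces are over $\mathbb{K}=\mathbb{R}$ or $\mathbb{C}$. A quasi-norm with constant $C\geq1$ on a vector space $\mathbb{X}$ is a map $\Vert\cdot\Vert:\mathbb{X}\to[0,\infty)$ with $\Vert x\Vert=0\iff x=0$, $\Vert\lambda x\Vert=|\lambda|\Vert x\Vert$, and $\Vert x+y\Vert\leq C(\Vert x\Vert+\Vert y\Vert)$. For $\varrho\in(0,1]$, a $\varrho$-norm satisfies instead of the last condition $\Vert x+y\Vert^{\varrho}\leq\Vert x\Vert^{\varrho}+\Vert y\Vert^{\varrho}$. Two such functionals are equivalent if each is bounded by a constant multiple of the other; every quasi-norm has an equivalent $\varrho$-norm for some $\varrho\in(0,1]$. A quasi-Banach space is a complete quasi-normed space. $\mathcal{L}(\mathbb{X},\mathbb{Y})$ is the space of bounded linear operators, with $\Vert T\Vert=\sup_{\Vert x\Vert_{\mathbb{X}}\leq1}\Vert Tx\Vert_{\mathbb{Y}}$; $\operatorname{rank}T$ is the dimension of the range of $T$. An operator is compact if it maps bounded sets to relatively compact sets. For $n\in\mathbb{N}=\{1,2,\ldots\}$ and $T\in\mathcal{L}(\mathbb{X},\mathbb{Y})$, the $n$-th Kolmogorov number is $$d_{n}(T):=\inf_{U_{n}\subset\mathbb{Y},\ \dim U_{n}<n}\ \sup_{\Vert x\Vert_{\mathbb{X}}\leq1}\ \inf_{y\in U_{n}}\Vert Tx-y\Vert_{\mathbb{Y}},$$ where the outer infimum is over linear subspaces $U_n$ of $\mathbb{Y}$. *)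

theory Defs
  imports "HOL-Analysis.Analysis"
begin

(* The scalar field is a type of class real_normed_field; in the theorem it is also required
   to be heine_borel. By the Gelfand-Mazur theorem real and complex are, up to isometric
   isomorphism, the only such fields. *)

subsection \<open>Quasi-Banach spaces\<close>

locale homogeneous_norm = vector_space scale
  for scale :: "'k::real_normed_field \<Rightarrow> 'x::ab_group_add \<Rightarrow> 'x" +
  fixes N :: "'x \<Rightarrow> real"
  assumes nonneg: "0 \<le> N x"
    and eq_zero_iff: "N x = 0 \<longleftrightarrow> x = 0"
    and homogeneous: "N (scale a x) = norm a * N x"

locale quasi_norm = homogeneous_norm scale N
  for scale :: "'k::real_normed_field \<Rightarrow> 'x::ab_group_add \<Rightarrow> 'x" and N +
  fixes C :: real
  assumes const_ge_1: "1 \<le> C"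
    and quasi_triangle: "N (x + y) \<le> C * (N x + N y)"

locale rho_norm = homogeneous_norm scale N
  for scale :: "'k::real_normed_field \<Rightarrow> 'x::ab_group_add \<Rightarrow> 'x" and N +
  fixes rho :: real
  assumes rho_pos: "0 < rho" and rho_le_1: "rho \<le> 1"
    and rho_triangle: "N (x + y) powr rho \<le> N x powr rho + N y powr rho"

locale quasi_banach = quasi_norm scale N C
  for scale :: "'k::real_normed_field \<Rightarrow> 'x::ab_group_add \<Rightarrow> 'x" and N C +
  assumes complete:
    "(\<forall>e>0. \<exists>n0. \<forall>i\<ge>n0. \<forall>j\<ge>n0. N (f i - f j) < e) \<Longrightarrow> \<exists>l. (\<lambda>i. N (f i - l)) \<longlonglongrightarrow> 0"

definition equivalent_norms :: "('x \<Rightarrow> real) \<Rightarrow> ('x \<Rightarrow> real) \<Rightarrow> bool" where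
  "equivalent_norms N N' \<longleftrightarrow> (\<exists>c. \<forall>x. N x \<le> c * N' x) \<and> (\<exists>c. \<forall>x. N' x \<le> c * N x)"

(* Balls of a quasi-norm need not be open in this topology, but they are neighbourhoods
   of their centres. *)
definition norm_topology :: "('x::ab_group_add \<Rightarrow> real) \<Rightarrow> 'x topology" where
  "norm_topology N = topology (\<lambda>U. \<forall>x\<in>U. \<exists>e>0. \<forall>y. N (y - x) < e \<longrightarrow> y \<in> U)"

lemma openin_norm_topology:
  "openin (norm_topology N) U \<longleftrightarrow> (\<forall>x\<in>U. \<exists>e>0. \<forall>y. N (y - x) < e \<longrightarrow> y \<in> U)"
proof -
  have "istopology (\<lambda>U. \<forall>x\<in>U. \<exists>e>0. \<forall>y. N (y - x) < e \<longrightarrow> y \<in> U)"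
    unfolding istopology_def
  proof (intro conjI allI impI ballI)
    fix S T x
    assume "\<forall>x\<in>S. \<exists>e>0. \<forall>y. N (y - x) < e \<longrightarrow> y \<in> S"
      and "\<forall>x\<in>T. \<exists>e>0. \<forall>y. N (y - x) < e \<longrightarrow> y \<in> T" and "x \<in> S \<inter> T"
    then obtain d e where "d > 0" "\<forall>y. N (y - x) < d \<longrightarrow> y \<in> S"
      and "e > 0" "\<forall>y. N (y - x) < e \<longrightarrow> y \<in> T"
      by blast
    then show "\<exists>e>0. \<forall>y. N (y - x) < e \<longrightarrow> y \<in> S \<inter> T"
      by (intro exI[of _ "min d e"]) auto
  next
    fix K x
    assume "\<forall>S\<in>K. \<forall>x\<in>S. \<exists>e>0. \<forall>y. N (y - x) < e \<longrightarrow> y \<in> S" and "x \<in> \<Union>K"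
    then show "\<exists>e>0. \<forall>y. N (y - x) < e \<longrightarrow> y \<in> \<Union>K"
      by (meson UnionE UnionI)
  qed
  then show ?thesis
    by (simp add: norm_topology_def topology_inverse')
qed

subsection \<open>Dimension\<close>

(* The library's dim is a natural number and is 0 on infinite-dimensional spaces. *)
definition (in vector_space) edim :: "'b set \<Rightarrow> enat" where
  "edim V = (if \<exists>B. finite B \<and> V \<subseteq> span B then enat (dim V) else \<infinity>)"

subsection \<open>Operators\<close>

definition bounded_operators ::
  "('k::real_normed_field \<Rightarrow> 'x::ab_group_add \<Rightarrow> 'x) \<Rightarrow> ('x \<Rightarrow> real) \<Rightarrow>
   ('k \<Rightarrow> 'y::ab_group_add \<Rightarrow> 'y) \<Rightarrow> ('y \<Rightarrow> real) \<Rightarrow> ('x \<Rightarrow> 'y) set" where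
  "bounded_operators sX NX sY NY =
     {T. Vector_Spaces.linear sX sY T \<and> (\<exists>K. \<forall>x. NY (T x) \<le> K * NX x)}"

definition operator_norm :: "('x \<Rightarrow> real) \<Rightarrow> ('y \<Rightarrow> real) \<Rightarrow> ('x \<Rightarrow> 'y) \<Rightarrow> real" where
  "operator_norm NX NY T = (SUP x\<in>{x. NX x \<le> 1}. NY (T x))"

definition operator_rank ::
  "('k::field \<Rightarrow> 'y::ab_group_add \<Rightarrow> 'y) \<Rightarrow> ('x \<Rightarrow> 'y) \<Rightarrow> enat" where
  "operator_rank sY T = vector_space.edim sY (range T)"

definition compact_operator ::
  "('x \<Rightarrow> real) \<Rightarrow> ('y::ab_group_add \<Rightarrow> real) \<Rightarrow> ('x \<Rightarrow> 'y) \<Rightarrow> bool" where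
  "compact_operator NX NY T \<longleftrightarrow>
     (\<forall>A. (\<exists>M. \<forall>x\<in>A. NX x \<le> M) \<longrightarrow>
       compactin (norm_topology NY) (norm_topology NY closure_of (T ` A)))"

(* For bounded T and n > 0 all suprema and infima are over nonempty bounded sets of reals.
   The value at n = 0, where no subspace U is admissible, is meaningless. *)
definition kolmogorov_number ::
  "('x \<Rightarrow> real) \<Rightarrow> ('k::field \<Rightarrow> 'y::ab_group_add \<Rightarrow> 'y) \<Rightarrow> ('y \<Rightarrow> real) \<Rightarrow> nat \<Rightarrow> ('x \<Rightarrow> 'y) \<Rightarrow> real"
  where
  "kolmogorov_number NX sY NY n T =
     (INF U\<in>{U. module.subspace sY U \<and> vector_space.edim sY U < enat n}.
        SUP x\<in>{x. NX x \<le> 1}. INF y\<in>U. NY (T x - y))"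

end

theory Submission
  imports Defs
begin

text \<open>
  By homogeneity, \<open>d\<^sub>n(T) < r\<close> provides fewer than \<open>n\<close> vectors whose span approximates every
  \<open>T x\<close> up to \<open>r \<cdot> \<parallel>x\<parallel>\<close>, and conversely such vectors give \<open>d\<^sub>n(T) \<le> r\<close>
  (\<open>kolmogorov_number_lessE\<close>, \<open>kolmogorov_number_le\<close>). This turns every nested infimum and supremum
  into a statement about finite spanning sets. For a sum one takes the union of the two spanning
  sets; for a product \<open>S T\<close> one approximates \<open>T x\<close> by \<open>v\<close>, then \<open>S (T x - v)\<close> by \<open>u\<close>, so that
  \<open>u + S v\<close> approximates \<open>S T x\<close>. The inequalities between the Kolmogorov numbers themselves follow
  by letting the approximation errors decrease to them.

  The remaining two properties need some analysis of finite-dimensional subspaces. Because bounded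
  sets of scalars are relatively compact, bounded sequences in such a subspace have convergent
  subsequences (\<open>bolzano_weierstrass_finite_span\<close>, by induction on the spanning set). So a point
  outside the subspace has positive distance from it, and the classical proof of Riesz's lemma carries
  over: the error of a near-best approximation to this point cannot itself be approximated well. This
  gives the lower bound \<open>d\<^sub>n(id) \<ge> 1\<close>. Also, bounded subsets of the subspace are totally bounded.

  Compactness is reduced to total boundedness: in a complete quasi-normed space, the closure of a
  totally bounded set is compact, and compact sets are totally bounded. If the image of the unit
  ball has a finite \<open>\<epsilon>\<close>-net, the span of the net shows \<open>d\<^sub>n(T) \<le> \<epsilon>\<close> for large \<open>n\<close>. If
  \<open>d\<^sub>n(T) \<rightarrow> 0\<close>, the image of a bounded set lies close to a bounded subset of a finite-dimensional
  subspace, and a finite net for the latter serves for the image as well.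
\<close>

section \<open>Quasi-normed spaces\<close>

context homogeneous_norm
begin

lemma N_zero [simp]: "N 0 = 0"
  by (simp add: eq_zero_iff)

lemma N_minus [simp]: "N (- x) = N x"
  using homogeneous[of "-1" x] by simp

lemma N_diff_commute: "N (x - y) = N (y - x)"
  using N_minus[of "x - y"] by simp

end

context quasi_norm
begin

lemma const_pos: "0 < C"
  using const_ge_1 by simp

lemma N_add_bound: "N x \<le> a \<Longrightarrow> N y \<le> b \<Longrightarrow> N (x + y) \<le> C * (a + b)"
  using quasi_triangle[of x y] mult_left_mono[of "N x + N y" "a + b" C] const_pos by linarith

lemma N_diff_bound: "N (x - z) \<le> a \<Longrightarrow> N (z - y) \<le> b \<Longrightarrow> N (x - y) \<le> C * (a + b)"
  using N_add_bound[of "x - z" a "z - y" b] by simp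

lemma limit_eqI:
  assumes "(\<lambda>k. N (v - x k)) \<longlonglongrightarrow> 0" and "(\<lambda>k. N (x k - l)) \<longlonglongrightarrow> 0"
  shows "v = l"
proof -
  have "(\<lambda>k. C * (N (v - x k) + N (x k - l))) \<longlonglongrightarrow> C * (0 + 0)"
    by (intro tendsto_intros assms)
  moreover have "N (v - l) \<le> C * (N (v - x k) + N (x k - l))" for k
    by (rule N_diff_bound) auto
  ultimately have "N (v - l) \<le> C * (0 + 0)"
    by (intro LIMSEQ_le_const) auto
  then show ?thesis
    using nonneg[of "v - l"] eq_zero_iff[of "v - l"] by simp
qed

definition totally_bounded_set :: "'x set \<Rightarrow> bool" where
  "totally_bounded_set A \<longleftrightarrow> (\<forall>e>0. \<exists>F. finite F \<and> (\<forall>x\<in>A. \<exists>c\<in>F. N (x - c) < e))"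

definition bolzano_weierstrass :: "'x set \<Rightarrow> bool" where
  "bolzano_weierstrass U \<longleftrightarrow>
     (\<forall>x M. (\<forall>k::nat. x k \<in> U \<and> N (x k) \<le> M) \<longrightarrow>
       (\<exists>l\<in>U. \<exists>r. strict_mono r \<and> (\<lambda>k. N (x (r k) - l)) \<longlonglongrightarrow> 0))"

lemma bolzano_weierstrassE:
  assumes "bolzano_weierstrass U" and "\<And>k::nat. x k \<in> U" and "\<And>k. N (x k) \<le> M"
  obtains l r where "l \<in> U" "strict_mono (r :: nat \<Rightarrow> nat)" "(\<lambda>k. N (x (r k) - l)) \<longlonglongrightarrow> 0"
  using assms unfolding bolzano_weierstrass_def by meson

text \<open>
  A minimizing sequence for the distance is bounded, so if the distance were zero, a subsequence would
  converge inside \<open>U\<close>, and its limit would be \<open>v\<close>.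
\<close>

lemma positive_distance:
  assumes U: "bolzano_weierstrass U" and v: "v \<notin> U"
  obtains \<delta> where "0 < \<delta>" "\<And>u. u \<in> U \<Longrightarrow> \<delta> \<le> N (v - u)"
proof (rule ccontr)
  assume "\<not> thesis"
  then have "\<forall>\<delta>>0. \<exists>u\<in>U. N (v - u) < \<delta>"
    using that by (meson not_le_imp_less)
  then have "\<forall>k::nat. \<exists>u\<in>U. N (v - u) < 1 / (real k + 1)"
    by simp
  then obtain u where u: "\<And>k::nat. u k \<in> U" "\<And>k::nat. N (v - u k) < 1 / (real k + 1)"
    by metis
  have lim: "(\<lambda>k. N (v - u k)) \<longlonglongrightarrow> 0"
  proof (rule tendsto_sandwich[where f = "\<lambda>_. 0" and h = "\<lambda>k. 1 / (real k + 1)"])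
    show "(\<lambda>k. 1 / (real k + 1)) \<longlonglongrightarrow> 0"
      using LIMSEQ_inverse_real_of_nat by (simp add: inverse_eq_divide add.commute)
  qed (use u(2) in \<open>auto simp: nonneg intro!: always_eventually less_imp_le\<close>)
  have bound: "N (u k) \<le> C * (1 + N v)" for k
  proof -
    have "1 / (real k + 1) \<le> 1"
      by simp
    then have "N (u k - v) \<le> 1"
      using u(2)[of k] N_diff_commute[of v "u k"] by linarith
    then show ?thesis
      using N_diff_bound[of "u k" v 1 0 "N v"] by simp
  qed
  obtain l r where l: "l \<in> U" and r: "strict_mono (r :: nat \<Rightarrow> nat)"
      and conv: "(\<lambda>k. N (u (r k) - l)) \<longlonglongrightarrow> 0"
    by (rule bolzano_weierstrassE[OF U u(1) bound])
  have "v = l"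
    by (rule limit_eqI[OF _ conv]) (use LIMSEQ_subseq_LIMSEQ[OF lim r] in \<open>simp add: o_def\<close>)
  then show False
    using l v by simp
qed

text \<open>
  Without a finite \<open>e\<close>-net one can choose a sequence of points at mutual distance at least \<open>e\<close>, and no
  subsequence of it converges.
\<close>

lemma bounded_imp_totally_bounded:
  assumes U: "bolzano_weierstrass U" and A: "A \<subseteq> U" "\<And>x. x \<in> A \<Longrightarrow> N x \<le> M"
  shows "totally_bounded_set A"
proof (rule ccontr)
  assume "\<not> totally_bounded_set A"
  then obtain e where e: "e > 0"
      and no_net: "\<And>F. finite F \<Longrightarrow> \<exists>x\<in>A. \<forall>c\<in>F. e \<le> N (x - c)"
    unfolding totally_bounded_set_def by (meson not_less)
  let ?sep = "\<lambda>x n y. y \<in> A \<and> (\<forall>m<n::nat. e \<le> N (y - x m))"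
  have "\<exists>x. \<forall>n::nat. ?sep x n (x n)"
  proof (rule dependent_wellorder_choice)
    fix n :: nat and x :: "nat \<Rightarrow> 'x"
    show "\<exists>y. ?sep x n y"
      using no_net[of "x ` {..<n}"] by auto
  qed simp
  then obtain x where sep: "\<forall>n. ?sep x n (x n)"
    by (rule exE)
  have x: "x n \<in> A" "m < n \<Longrightarrow> e \<le> N (x n - x m)" for m n
    using sep by simp_all
  have x_U: "x n \<in> U" and x_M: "N (x n) \<le> M" for n
    using x(1) A by auto
  obtain l r where r: "strict_mono (r :: nat \<Rightarrow> nat)"
      and conv: "(\<lambda>k. N (x (r k) - l)) \<longlonglongrightarrow> 0"
    by (rule bolzano_weierstrassE[OF U x_U x_M])
  have "\<forall>\<^sub>F k in sequentially. N (x (r k) - l) < e / (4 * C)"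
    using conv e const_pos by (intro order_tendstoD) auto
  then obtain k where k: "\<And>j. j \<ge> k \<Longrightarrow> N (x (r j) - l) < e / (4 * C)"
    unfolding eventually_sequentially by blast
  have "N (x (r (Suc k)) - x (r k)) \<le> C * (e / (4 * C) + e / (4 * C))"
    using k[of "Suc k"] k[of k] N_diff_commute[of l "x (r k)"]
    by (intro N_diff_bound[where z = l]) auto
  also have "\<dots> < e"
    using e const_pos by (simp add: field_simps)
  finally show False
    using x(2)[of "r k" "r (Suc k)"] strict_monoD[OF r, of k "Suc k"] by simp
qed

end

section \<open>Finite-dimensional subspaces\<close>

text \<open>
  Bounded sequences of scalars now have convergent subsequences, which is what makes
  finite-dimensional subspaces behave as they do over the real or complex numbers.
\<close>

locale quasi_norm_heine_borel_scalars = quasi_norm scale N C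
  for scale :: "'k::{real_normed_field,heine_borel} \<Rightarrow> 'x::ab_group_add \<Rightarrow> 'x" and N C
begin

text \<open>
  The positive distance \<open>\<delta>\<close> of \<open>v\<close> from \<open>span B\<close> bounds the \<open>v\<close>-coefficient of a vector \<open>x\<close> by
  \<open>N x / \<delta>\<close>. In a bounded sequence, the coefficients and hence also the components in \<open>span B\<close> are
  bounded, and successive subsequences make both of them converge.
\<close>

lemma bolzano_weierstrass_insert:
  assumes U: "bolzano_weierstrass (span B)" and v: "v \<notin> span B"
  shows "bolzano_weierstrass (span (insert v B))"
  unfolding bolzano_weierstrass_def
proof (intro allI impI)
  fix x M
  assume x: "\<forall>k::nat. x k \<in> span (insert v B) \<and> N (x k) \<le> M"
  then have "\<forall>k. \<exists>a. x k - scale a v \<in> span B"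
    by (simp add: span_breakdown_eq)
  then obtain a where a: "\<And>k. x k - scale (a k) v \<in> span B"
    by metis
  obtain \<delta> where \<delta>: "0 < \<delta>" "\<And>u. u \<in> span B \<Longrightarrow> \<delta> \<le> N (v - u)"
    using positive_distance[OF U v] by blast
  have a_bound: "norm (a k) \<le> M / \<delta>" for k
  proof (cases "a k = 0")
    case True
    have "0 \<le> M"
      using x nonneg order_trans by blast
    with True \<delta> show ?thesis
      by simp
  next
    case False
    \<comment> \<open>Chosen so that \<open>x k = a k * (v - u)\<close>, which has norm at least \<open>norm (a k) * \<delta>\<close>.\<close>
    define u where "u = scale (- inverse (a k)) (x k - scale (a k) v)"
    have "u \<in> span B"
      unfolding u_def by (rule span_scale[OF a])
    moreover have "scale (a k) (v - u) = x k"
      using False by (simp add: u_def scale_right_diff_distrib scale_minus_right)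
    ultimately have "norm (a k) * \<delta> \<le> N (x k)"
      using homogeneous[of "a k" "v - u"] \<delta>(2)[of u] by (simp add: mult_left_mono)
    then show ?thesis
      using x \<delta>(1) by (meson order_trans pos_le_divide_eq)
  qed
  have "bounded (range a)"
    using a_bound by (intro boundedI[of _ "M / \<delta>"]) auto
  then obtain b r1 where r1: "strict_mono (r1 :: nat \<Rightarrow> nat)" and b: "(a \<circ> r1) \<longlonglongrightarrow> b"
    using bounded_imp_convergent_subsequence by blast
  define w where "w = (\<lambda>k. x k - scale (a k) v)"
  have bound: "N (w k) \<le> C * (M + M / \<delta> * N v)" for k
  proof -
    have "N (- scale (a k) v) \<le> M / \<delta> * N v"
      using a_bound[of k] nonneg[of v] by (simp add: homogeneous mult_right_mono del: times_divide_eq_left)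
    then show ?thesis
      using N_add_bound[of "x k" M "- scale (a k) v"] x by (simp add: w_def)
  qed
  have w_span: "w k \<in> span B" for k
    using a unfolding w_def .
  obtain l r2 where l: "l \<in> span B" and r2: "strict_mono (r2 :: nat \<Rightarrow> nat)"
      and conv: "(\<lambda>k. N (w (r1 (r2 k)) - l)) \<longlonglongrightarrow> 0"
    by (rule bolzano_weierstrassE[OF U, of "\<lambda>k. w (r1 k)", OF w_span bound])
  have lim_a: "(\<lambda>k. a (r1 (r2 k))) \<longlonglongrightarrow> b"
    using LIMSEQ_subseq_LIMSEQ[OF b r2] by (simp add: o_def)
  define L where "L = l + scale b v"
  have "(\<lambda>k. N (x ((r1 \<circ> r2) k) - L)) \<longlonglongrightarrow> 0"
  proof (rule tendsto_sandwich[where f = "\<lambda>_. 0"])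
    have "N (x ((r1 \<circ> r2) k) - L)
        \<le> C * (N (w (r1 (r2 k)) - l) + norm (a (r1 (r2 k)) - b) * N v)" for k
    proof -
      have "x ((r1 \<circ> r2) k) - L = (w (r1 (r2 k)) - l) + scale (a (r1 (r2 k)) - b) v"
        by (simp add: w_def L_def scale_left_diff_distrib)
      then show ?thesis
        using quasi_triangle[of "w (r1 (r2 k)) - l" "scale (a (r1 (r2 k)) - b) v"]
        by (simp only: homogeneous)
    qed
    then show "\<forall>\<^sub>F k in sequentially. N (x ((r1 \<circ> r2) k) - L)
        \<le> C * (N (w (r1 (r2 k)) - l) + norm (a (r1 (r2 k)) - b) * N v)"
      by simp
    have "(\<lambda>k. C * (N (w (r1 (r2 k)) - l) + norm (a (r1 (r2 k)) - b) * N v))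
        \<longlonglongrightarrow> C * (0 + norm (b - b) * N v)"
      by (intro tendsto_intros conv lim_a)
    then show "(\<lambda>k. C * (N (w (r1 (r2 k)) - l) + norm (a (r1 (r2 k)) - b) * N v)) \<longlonglongrightarrow> 0"
      by simp
  qed (auto simp: nonneg)
  moreover have "L \<in> span (insert v B)"
    using l by (auto simp: span_breakdown_eq L_def intro!: exI[of _ b])
  moreover have "strict_mono (r1 \<circ> r2)"
    using r1 r2 by (rule strict_mono_o)
  ultimately show "\<exists>l\<in>span (insert v B). \<exists>r. strict_mono r \<and> (\<lambda>k. N (x (r k) - l)) \<longlonglongrightarrow> 0"
    by blast
qed

lemma bolzano_weierstrass_finite_span: "finite B \<Longrightarrow> bolzano_weierstrass (span B)"
proof (induction B rule: finite_induct)
  case empty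
  show ?case
    unfolding bolzano_weierstrass_def
  proof (intro allI impI)
    fix x M assume "\<forall>k::nat. x k \<in> span {} \<and> N (x k) \<le> M"
    then have "(\<lambda>k. N (x (id k) - 0)) \<longlonglongrightarrow> 0"
      by simp
    then show "\<exists>l\<in>span {}. \<exists>r. strict_mono r \<and> (\<lambda>k. N (x (r k) - l)) \<longlonglongrightarrow> 0"
      by (intro bexI[of _ 0] exI[of _ id] conjI strict_mono_id span_zero)
  qed
next
  case (insert v B)
  show ?case
  proof (cases "v \<in> span B")
    case True
    then show ?thesis
      using insert.IH by (simp add: span_redundant)
  next
    case False
    with insert.IH show ?thesis
      by (rule bolzano_weierstrass_insert)
  qed
qed

lemma bounded_subset_span_totally_bounded:
  assumes "finite B" "A \<subseteq> span B" "\<And>x. x \<in> A \<Longrightarrow> N x \<le> M"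
  shows "totally_bounded_set A"
  by (rule bounded_imp_totally_bounded[OF bolzano_weierstrass_finite_span[OF assms(1)] assms(2,3)])

text \<open>
  The error \<open>x = v - u\<close> of a near-best approximation \<open>u\<close> to a point \<open>v\<close> outside the span: every
  \<open>x - y\<close> with \<open>y\<close> in the span is again an error in approximating \<open>v\<close>, hence not much smaller.
\<close>

lemma riesz_lemma:
  assumes B: "finite B" "span B \<noteq> UNIV" and r: "r < 1"
  shows "\<exists>x. \<forall>y\<in>span B. r * N x < N (x - y)"
proof -
  obtain v where v: "v \<notin> span B"
    using B(2) by blast
  obtain \<delta> where \<delta>: "0 < \<delta>" "\<And>u. u \<in> span B \<Longrightarrow> \<delta> \<le> N (v - u)"
    using positive_distance[OF bolzano_weierstrass_finite_span[OF B(1)] v] by blast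
  define d where "d = (INF u\<in>span B. N (v - u))"
  have bdd: "bdd_below ((\<lambda>u. N (v - u)) ` span B)"
    by (rule bdd_belowI2[of _ 0]) (rule nonneg)
  have ne: "span B \<noteq> {}"
    using span_zero by blast
  have "\<delta> \<le> d"
    unfolding d_def by (rule cINF_greatest[OF ne \<delta>(2)])
  then have "d > 0"
    using \<delta>(1) by simp
  have d_le: "d \<le> N (v - u)" if "u \<in> span B" for u
    unfolding d_def by (rule cINF_lower[OF bdd that])
  \<comment> \<open>For \<open>r \<le> 0\<close> any \<open>u\<close> will do; otherwise \<open>d / r\<close> exceeds the infimum \<open>d\<close>.\<close>
  have "\<exists>u\<in>span B. r * N (v - u) < d"
  proof (cases "r \<le> 0")
    case True
    have "r * N (v - 0) \<le> 0"
      by (rule mult_nonpos_nonneg[OF True nonneg])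
    then show ?thesis
      using \<open>d > 0\<close> span_zero by (intro bexI[of _ 0]) auto
  next
    case False
    then have "d < d / r"
      using r \<open>d > 0\<close> by (simp add: field_simps)
    then obtain u where "u \<in> span B" "N (v - u) < d / r"
      using cINF_less_iff[OF ne bdd] unfolding d_def by blast
    then show ?thesis
      using False by (auto simp: field_simps intro!: bexI[of _ u])
  qed
  then obtain u where u: "u \<in> span B" "r * N (v - u) < d"
    by blast
  show ?thesis
  proof (intro exI ballI)
    fix y assume "y \<in> span B"
    then have "d \<le> N (v - (u + y))"
      by (intro d_le span_add u(1))
    then show "r * N (v - u) < N (v - u - y)"
      using u(2) by (simp add: diff_diff_eq)
  qed
qed

end

section \<open>Compactness in the topology of a quasi-norm\<close>

context quasi_norm
begin

lemma topspace_norm_topology [simp]: "topspace (norm_topology N) = UNIV"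
proof -
  have "openin (norm_topology N) UNIV"
    unfolding openin_norm_topology using zero_less_one by blast
  then show ?thesis
    using openin_subset by blast
qed

text \<open>
  Balls of a quasi-norm need not be open. The points that have some ball around them inside the given
  ball do form an open set, because a ball around \<open>y\<close> of radius \<open>d\<close> contains, for every point \<open>z\<close>
  close to \<open>y\<close>, a ball around \<open>z\<close> of radius \<open>d / (4 * C)\<close>.
\<close>

lemma open_core_of_ball:
  assumes "e > 0"
  obtains V where "openin (norm_topology N) V" "x \<in> V" "V \<subseteq> {y. N (y - x) < e}"
proof
  define V where "V = {y. \<exists>d>0. \<forall>z. N (z - y) < d \<longrightarrow> N (z - x) < e}"
  have VI: "y \<in> V" if "d > 0" "\<And>z. N (z - y) < d \<Longrightarrow> N (z - x) < e" for y d
    using that unfolding V_def by blast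
  have VE: "\<exists>d>0. \<forall>z. N (z - y) < d \<longrightarrow> N (z - x) < e" if "y \<in> V" for y
    using that unfolding V_def by blast
  show "openin (norm_topology N) V"
    unfolding openin_norm_topology
  proof
    fix y assume "y \<in> V"
    then obtain d where d: "d > 0" "\<And>z. N (z - y) < d \<Longrightarrow> N (z - x) < e"
      using VE by blast
    have pos: "d / (4 * C) > 0"
      using d(1) const_pos by simp
    have "z \<in> V" if z: "N (z - y) < d / (4 * C)" for z
    proof (rule VI[OF pos])
      fix w assume w: "N (w - z) < d / (4 * C)"
      have "N (w - y) \<le> C * (d / (4 * C) + d / (4 * C))"
        by (rule N_diff_bound[where z = z]) (use w z in auto)
      also have "\<dots> < d"
        using d(1) const_pos by (simp add: field_simps)
      finally show "N (w - x) < e"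
        by (rule d(2))
    qed
    then show "\<exists>e>0. \<forall>z. N (z - y) < e \<longrightarrow> z \<in> V"
      using pos by blast
  qed
  show "x \<in> V"
    using VI[OF assms] by simp
  show "V \<subseteq> {y. N (y - x) < e}"
  proof
    fix y assume "y \<in> V"
    then show "y \<in> {y. N (y - x) < e}"
      using VE[of y] by auto
  qed
qed

text \<open>
  The open cores of balls allow the closure to be computed with balls, as in a metric space.
\<close>

lemma closure_of_iff:
  "x \<in> norm_topology N closure_of A \<longleftrightarrow> (\<forall>e>0. \<exists>a\<in>A. N (a - x) < e)"
proof
  assume x: "x \<in> norm_topology N closure_of A"
  show "\<forall>e>0. \<exists>a\<in>A. N (a - x) < e"
  proof (intro allI impI)
    fix e :: real assume "e > 0"
    then obtain V where "openin (norm_topology N) V" "x \<in> V" "V \<subseteq> {y. N (y - x) < e}"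
      using open_core_of_ball by blast
    then show "\<exists>a\<in>A. N (a - x) < e"
      using x unfolding in_closure_of by blast
  qed
next
  assume "\<forall>e>0. \<exists>a\<in>A. N (a - x) < e"
  then show "x \<in> norm_topology N closure_of A"
    unfolding in_closure_of openin_norm_topology by (auto, meson)
qed

lemma totally_bounded_closure:
  assumes "totally_bounded_set A"
  shows "totally_bounded_set (norm_topology N closure_of A)"
  unfolding totally_bounded_set_def
proof (intro allI impI)
  fix e :: real assume e: "e > 0"
  have pos: "e / (4 * C) > 0"
    using e const_pos by simp
  then obtain F where F: "finite F" "\<And>x. x \<in> A \<Longrightarrow> \<exists>c\<in>F. N (x - c) < e / (4 * C)"
    using assms unfolding totally_bounded_set_def by meson
  have "\<exists>c\<in>F. N (x - c) < e" if x: "x \<in> norm_topology N closure_of A" for x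
  proof -
    obtain a where a: "a \<in> A" "N (a - x) < e / (4 * C)"
      using x pos unfolding closure_of_iff by blast
    obtain c where c: "c \<in> F" "N (a - c) < e / (4 * C)"
      using F(2)[OF a(1)] by blast
    have "N (x - c) \<le> C * (e / (4 * C) + e / (4 * C))"
      using a(2) c(2) N_diff_commute[of a x] by (intro N_diff_bound[where z = a]) auto
    also have "\<dots> < e"
      using e const_pos by (simp add: field_simps)
    finally show ?thesis
      using c(1) by blast
  qed
  then show "\<exists>F. finite F \<and> (\<forall>x\<in>norm_topology N closure_of A. \<exists>c\<in>F. N (x - c) < e)"
    using F(1) by blast
qed

lemma compactin_imp_totally_bounded:
  assumes K: "compactin (norm_topology N) K"
  shows "totally_bounded_set K"
  unfolding totally_bounded_set_def
proof (intro allI impI)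
  fix e :: real assume "e > 0"
  then have "\<forall>c. \<exists>V. openin (norm_topology N) V \<and> c \<in> V \<and> V \<subseteq> {y. N (y - c) < e}"
    using open_core_of_ball[of e] by blast
  then obtain V where "\<forall>c. openin (norm_topology N) (V c) \<and> c \<in> V c \<and> V c \<subseteq> {y. N (y - c) < e}"
    by (rule choice[THEN exE])
  then have V: "openin (norm_topology N) (V c)" "c \<in> V c" "V c \<subseteq> {y. N (y - c) < e}" for c
    by simp_all
  have "Ball (range V) (openin (norm_topology N)) \<and> K \<subseteq> \<Union>(range V)"
    using V(1,2) by auto
  then have "\<exists>\<F>. finite \<F> \<and> \<F> \<subseteq> range V \<and> K \<subseteq> \<Union>\<F>"
    using K unfolding compactin_def by simp
  then obtain F where "finite F" "K \<subseteq> \<Union>(V ` F)"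
    by (metis finite_subset_image)
  then show "\<exists>F. finite F \<and> (\<forall>x\<in>K. \<exists>c\<in>F. N (x - c) < e)"
    using V(3) by (intro exI[of _ F]) blast
qed

lemma compact_operator_imp_totally_bounded:
  assumes "compact_operator M N T" and "\<And>x. x \<in> A \<Longrightarrow> M x \<le> R"
  shows "totally_bounded_set (T ` A)"
proof -
  have "totally_bounded_set (norm_topology N closure_of (T ` A))"
    using assms unfolding compact_operator_def by (blast intro: compactin_imp_totally_bounded)
  moreover have "T ` A \<subseteq> norm_topology N closure_of (T ` A)"
    by (rule closure_of_subset) simp
  ultimately show ?thesis
    unfolding totally_bounded_set_def by (meson subsetD)
qed

end

context quasi_banach
begin

text \<open>
  A variant of Cantor's intersection principle: points chosen from the sets form a Cauchy sequence,
  and since the diameters tend to zero, the sets end up in every ball around its limit.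
\<close>

lemma shrinking_sequence_limit:
  assumes small: "\<And>n. \<exists>c. \<forall>x\<in>S (Suc n). N (x - c) < 1 / real (Suc n)"
    and dec: "\<And>n. S (Suc n) \<subseteq> S n" and ne: "\<And>n. S n \<noteq> {}"
  obtains l where "\<And>e. e > 0 \<Longrightarrow> \<exists>n. \<forall>z\<in>S n. N (z - l) < e"
proof -
  define x where "x n = (SOME z. z \<in> S n)" for n
  have x: "x n \<in> S n" for n
    using ne[of n] by (simp add: x_def some_in_eq)
  have anti: "S j \<subseteq> S i" if "i \<le> j" for i j
    using lift_Suc_antimono_le[of S, OF dec that] .
  have diam: "\<exists>n. \<forall>y\<in>S n. \<forall>z\<in>S n. N (y - z) < e" if e: "e > 0" for e
  proof -
    obtain n where n: "1 / real (Suc n) < e / (4 * C)"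
      using e const_pos reals_Archimedean[of "e / (4 * C)"] by (auto simp: inverse_eq_divide)
    obtain c where c: "\<And>x. x \<in> S (Suc n) \<Longrightarrow> N (x - c) < 1 / real (Suc n)"
      using small by blast
    have "N (y - z) < e" if "y \<in> S (Suc n)" "z \<in> S (Suc n)" for y z
    proof -
      have "N (y - z) \<le> C * (e / (4 * C) + e / (4 * C))"
        using c[OF that(1)] c[OF that(2)] n N_diff_commute[of z c]
        by (intro N_diff_bound[where z = c]) auto
      also have "\<dots> < e"
        using e const_pos by (simp add: field_simps)
      finally show ?thesis .
    qed
    then show ?thesis
      by blast
  qed
  have "\<forall>e>0. \<exists>n0. \<forall>i\<ge>n0. \<forall>j\<ge>n0. N (x i - x j) < e"
    using diam x anti by (meson subsetD)
  then obtain l where l: "(\<lambda>i. N (x i - l)) \<longlonglongrightarrow> 0"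
    using complete by blast
  show thesis
  proof
    fix e :: real assume e: "e > 0"
    have pos: "e / (4 * C) > 0"
      using e const_pos by simp
    obtain n where n: "\<And>y z. y \<in> S n \<Longrightarrow> z \<in> S n \<Longrightarrow> N (y - z) < e / (4 * C)"
      using diam[OF pos] by blast
    have "\<forall>\<^sub>F i in sequentially. N (x i - l) < e / (4 * C)"
      using l pos by (rule order_tendstoD)
    then obtain k where k: "\<And>i. i \<ge> k \<Longrightarrow> N (x i - l) < e / (4 * C)"
      unfolding eventually_sequentially by blast
    have "N (z - l) < e" if z: "z \<in> S n" for z
    proof -
      have xm: "x (max n k) \<in> S n"
        using x anti[of n "max n k"] by auto
      have "N (z - l) \<le> C * (e / (4 * C) + e / (4 * C))"
        using n[OF z xm] k[of "max n k"] by (intro N_diff_bound[where z = "x (max n k)"]) auto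
      also have "\<dots> < e"
        using e const_pos by (simp add: field_simps)
      finally show ?thesis .
    qed
    then show "\<exists>n. \<forall>z\<in>S n. N (z - l) < e"
      by blast
  qed
qed

text \<open>
  A set is bad if finitely many members of the cover do not suffice for it. A bad set is a finite union
  of small pieces, one of which is bad. Iterating gives bad sets that shrink to a point of the
  closure; a single member of the cover contains a ball around this point and so a whole bad set.
\<close>

lemma totally_bounded_closure_compact:
  assumes A: "totally_bounded_set A"
  shows "compactin (norm_topology N) (norm_topology N closure_of A)"
  unfolding compactin_def
proof (intro conjI allI impI)
  let ?K = "norm_topology N closure_of A"
  show "?K \<subseteq> topspace (norm_topology N)"
    by simp
  fix \<U> assume \<U>: "Ball \<U> (openin (norm_topology N)) \<and> ?K \<subseteq> \<Union>\<U>"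
  define bad where "bad = (\<lambda>S. S \<subseteq> ?K \<and> \<not> (\<exists>\<F>. finite \<F> \<and> \<F> \<subseteq> \<U> \<and> S \<subseteq> \<Union>\<F>))"
  have split: "\<exists>S'. bad S' \<and> S' \<subseteq> S \<and> (\<exists>c. \<forall>x\<in>S'. N (x - c) < 1 / real (Suc n))"
    if S: "bad S" for S n
  proof (rule ccontr)
    assume contra: "\<not> ?thesis"
    have "\<exists>F. finite F \<and> (\<forall>x\<in>?K. \<exists>c\<in>F. N (x - c) < 1 / real (Suc n))"
      using totally_bounded_closure[OF A] unfolding totally_bounded_set_def by simp
    then obtain F where F: "finite F" "\<forall>x\<in>?K. \<exists>c\<in>F. N (x - c) < 1 / real (Suc n)"
      by blast
    define P where "P = (\<lambda>c. S \<inter> {x. N (x - c) < 1 / real (Suc n)})"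
    have "\<not> bad (P c)" for c
      using contra unfolding P_def by blast
    moreover have "P c \<subseteq> ?K" for c
      using S unfolding P_def bad_def by blast
    ultimately have "\<forall>c. \<exists>\<F>. finite \<F> \<and> \<F> \<subseteq> \<U> \<and> P c \<subseteq> \<Union>\<F>"
      unfolding bad_def by blast
    then obtain G where G: "\<And>c. finite (G c)" "\<And>c. G c \<subseteq> \<U>" "\<And>c. P c \<subseteq> \<Union>(G c)"
      by metis
    have "S \<subseteq> \<Union>(\<Union>c\<in>F. G c)"
    proof
      fix x assume x: "x \<in> S"
      then have "x \<in> ?K"
        using S unfolding bad_def by blast
      then obtain c where "c \<in> F" "x \<in> P c"
        using F(2) x unfolding P_def by blast
      then show "x \<in> \<Union>(\<Union>c\<in>F. G c)"
        using G(3) by blast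
    qed
    moreover have "finite (\<Union>c\<in>F. G c)" "(\<Union>c\<in>F. G c) \<subseteq> \<U>"
      using F(1) G by auto
    ultimately show False
      using S unfolding bad_def by blast
  qed
  show "\<exists>\<F>. finite \<F> \<and> \<F> \<subseteq> \<U> \<and> ?K \<subseteq> \<Union>\<F>"
  proof (rule ccontr)
    assume "\<not> ?thesis"
    then have bad_K: "bad ?K"
      unfolding bad_def by simp
    have "\<exists>S. \<forall>n. bad (S n) \<and> (S (Suc n) \<subseteq> S n \<and>
        (\<exists>c. \<forall>x\<in>S (Suc n). N (x - c) < 1 / real (Suc n)))"
      using bad_K split by (intro dependent_nat_choice) auto
    then obtain S where S: "\<And>n. bad (S n)" "\<And>n. S (Suc n) \<subseteq> S n"
        "\<And>n. \<exists>c. \<forall>x\<in>S (Suc n). N (x - c) < 1 / real (Suc n)"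
      by blast
    have ne: "S n \<noteq> {}" for n
      using S(1)[of n] unfolding bad_def by auto
    obtain l where l: "\<And>e. e > 0 \<Longrightarrow> \<exists>n. \<forall>z\<in>S n. N (z - l) < e"
      using shrinking_sequence_limit[OF S(3) S(2) ne] by metis
    have "l \<in> norm_topology N closure_of ?K"
      unfolding closure_of_iff
    proof (intro allI impI)
      fix e :: real assume "e > 0"
      then obtain n where n: "\<forall>z\<in>S n. N (z - l) < e"
        using l by blast
      obtain z where "z \<in> S n"
        using ne by blast
      then show "\<exists>a\<in>?K. N (a - l) < e"
        using n S(1)[of n] unfolding bad_def by blast
    qed
    then have "l \<in> ?K"
      by (simp add: closure_of_closure_of)
    then obtain G where G: "G \<in> \<U>" "l \<in> G" "openin (norm_topology N) G"
      using \<U> by blast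
    then obtain e where e: "e > 0" "\<And>y. N (y - l) < e \<Longrightarrow> y \<in> G"
      unfolding openin_norm_topology by blast
    obtain n where "\<forall>z\<in>S n. N (z - l) < e"
      using l[OF e(1)] by blast
    then have "S n \<subseteq> \<Union>{G}"
      using e(2) by auto
    then show False
      using S(1)[of n] G(1) unfolding bad_def by blast
  qed
qed

end

section \<open>Approximation by finite-dimensional subspaces\<close>

text \<open>
  Spanning sets are easier to join and to map than dimensions are to compare, so all later estimates
  of dimensions are estimates of cardinalities of spanning sets.
\<close>

lemma (in vector_space) edim_less_iff:
  "edim V < enat n \<longleftrightarrow> (\<exists>B. finite B \<and> card B < n \<and> V \<subseteq> span B)"
proof
  assume V: "edim V < enat n"
  then obtain F where F: "finite F" "V \<subseteq> span F"
    unfolding edim_def by (auto split: if_splits)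
  then have dim: "dim V < n"
    using V unfolding edim_def by (auto split: if_splits)
  obtain B where B: "B \<subseteq> V" "independent B" "V \<subseteq> span B" "card B = dim V"
    by (rule basis_exists)
  have "finite B"
    using independent_span_bound[OF F(1) B(2)] B(1) F(2) by blast
  then show "\<exists>B. finite B \<and> card B < n \<and> V \<subseteq> span B"
    using B dim by (intro exI[of _ B]) simp
next
  assume "\<exists>B. finite B \<and> card B < n \<and> V \<subseteq> span B"
  then obtain B where B: "finite B" "card B < n" "V \<subseteq> span B"
    by blast
  then have "dim V < n"
    using dim_le_card[of V B] by simp
  then show "edim V < enat n"
    using B unfolding edim_def by auto
qed

locale bounded_operator = X: homogeneous_norm sX NX + Y: homogeneous_norm sY NY
  for sX :: "'k::real_normed_field \<Rightarrow> 'x::ab_group_add \<Rightarrow> 'x" and NX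
    and sY :: "'k \<Rightarrow> 'y::ab_group_add \<Rightarrow> 'y" and NY +
  fixes T :: "'x \<Rightarrow> 'y"
  assumes bounded: "T \<in> bounded_operators sX NX sY NY"
begin

abbreviation kolm :: "nat \<Rightarrow> real" where
  "kolm n \<equiv> kolmogorov_number NX sY NY n T"

text \<open>
  The homogeneous form of the estimate, over all \<open>x\<close> instead of the unit ball, is the one that
  composes: it can be applied to an error \<open>T x - v\<close> of any size.
\<close>

definition approximable :: "'y set \<Rightarrow> real \<Rightarrow> bool" where
  "approximable U r \<longleftrightarrow> (\<forall>x. \<exists>y\<in>U. NY (T x - y) \<le> r * NX x)"

definition deviation :: "'y set \<Rightarrow> real" where
  "deviation U = (SUP x\<in>{x. NX x \<le> 1}. INF y\<in>U. NY (T x - y))"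

lemma linear_T: "Vector_Spaces.linear sX sY T"
  using bounded unfolding bounded_operators_def by simp

lemma T_scale: "T (sX a x) = sY a (T x)"
  using linear_T unfolding Vector_Spaces.linear_iff by simp

lemma T_zero: "T 0 = 0"
  using T_scale[of 0 0] by simp

lemma bound: "\<exists>K\<ge>0. \<forall>x. NY (T x) \<le> K * NX x"
proof -
  obtain K where K: "\<And>x. NY (T x) \<le> K * NX x"
    using bounded unfolding bounded_operators_def by blast
  have "NY (T x) \<le> \<bar>K\<bar> * NX x" for x
    using K[of x] mult_right_mono[OF abs_ge_self X.nonneg, of K x] by linarith
  then show ?thesis
    by (intro exI[of _ "\<bar>K\<bar>"]) simp
qed

lemma bdd_below_distances: "bdd_below ((\<lambda>y. NY (z - y)) ` U)"
  by (rule bdd_belowI2[of _ 0]) (rule Y.nonneg)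

lemma distance_le: "y \<in> U \<Longrightarrow> (INF y\<in>U. NY (z - y)) \<le> NY (z - y)"
  by (rule cINF_lower[OF bdd_below_distances])

text \<open>
  The supremum of reals defining \<open>deviation\<close> only has its intended meaning when it is taken over a
  bounded set; this is where the boundedness of \<open>T\<close> enters.
\<close>

lemma bdd_above_distances:
  assumes "0 \<in> U"
  shows "bdd_above ((\<lambda>x. INF y\<in>U. NY (T x - y)) ` {x. NX x \<le> 1})"
proof -
  obtain K where K: "0 \<le> K" "\<And>x. NY (T x) \<le> K * NX x"
    using bound by blast
  have "(INF y\<in>U. NY (T x - y)) \<le> K" if "NX x \<le> 1" for x
  proof -
    have "(INF y\<in>U. NY (T x - y)) \<le> NY (T x - 0)"
      by (rule distance_le[OF assms])
    also have "\<dots> \<le> K * 1"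
      using K(2)[of x] mult_left_mono[OF that K(1)] by simp
    finally show ?thesis
      by simp
  qed
  then show ?thesis
    by (intro bdd_aboveI2[of _ _ K]) simp
qed

lemma deviation_nonneg:
  assumes "0 \<in> U"
  shows "0 \<le> deviation U"
proof -
  have "0 \<le> (INF y\<in>U. NY (T 0 - y))"
    using assms by (intro cINF_greatest Y.nonneg) auto
  also have "\<dots> \<le> deviation U"
    unfolding deviation_def by (rule cSUP_upper[OF _ bdd_above_distances[OF assms]]) simp
  finally show ?thesis .
qed

lemma deviation_le:
  assumes U: "approximable U r" and r: "0 \<le> r"
  shows "deviation U \<le> r"
  unfolding deviation_def
proof (rule cSUP_least)
  have "0 \<in> {x. NX x \<le> 1}"
    by simp
  then show "{x. NX x \<le> 1} \<noteq> {}"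
    by blast
  fix x assume x: "x \<in> {x. NX x \<le> 1}"
  obtain y where y: "y \<in> U" "NY (T x - y) \<le> r * NX x"
    using U unfolding approximable_def by blast
  have "(INF y\<in>U. NY (T x - y)) \<le> r * NX x"
    using distance_le[OF y(1)] y(2) by (rule order_trans)
  also have "\<dots> \<le> r"
    using x r by (simp add: mult_left_le)
  finally show "(INF y\<in>U. NY (T x - y)) \<le> r" .
qed

text \<open>
  The norms are homogeneous and \<open>U\<close> is a subspace, so \<open>x\<close> can be rescaled by the scalar
  \<open>of_real (NX x)\<close> to a vector of norm one.
\<close>

lemma approximable_if_unit_sphere:
  assumes U: "Y.subspace U" and sphere: "\<And>z. NX z = 1 \<Longrightarrow> \<exists>y\<in>U. NY (T z - y) \<le> r"
  shows "approximable U r"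
  unfolding approximable_def
proof
  fix x
  show "\<exists>y\<in>U. NY (T x - y) \<le> r * NX x"
  proof (cases "x = 0")
    case True
    then show ?thesis
      using Y.subspace_0[OF U] T_zero by (intro bexI[of _ 0]) auto
  next
    case False
    define t :: 'k where "t = of_real (NX x)"
    have norm_t: "norm t = NX x" and t: "t \<noteq> 0"
      using False X.nonneg[of x] X.eq_zero_iff[of x] by (auto simp: t_def)
    define z where "z = sX (inverse t) x"
    have x: "x = sX t z"
      using t by (simp add: z_def)
    have "NX z = 1"
      using norm_t False by (simp add: z_def X.homogeneous norm_inverse X.eq_zero_iff)
    then obtain y where y: "y \<in> U" "NY (T z - y) \<le> r"
      using sphere by blast
    have "T x - sY t y = sY t (T z - y)"
      by (simp add: x T_scale Y.scale_right_diff_distrib)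
    then have "NY (T x - sY t y) = NX x * NY (T z - y)"
      by (simp add: Y.homogeneous norm_t)
    also have "\<dots> \<le> r * NX x"
      using mult_right_mono[OF y(2) X.nonneg[of x]] by (simp add: mult.commute)
    finally show ?thesis
      using Y.subspace_scale[OF U y(1)] by blast
  qed
qed

lemma approximable_if_deviation_less:
  assumes U: "Y.subspace U" and r: "deviation U < r"
  shows "approximable U r"
proof (rule approximable_if_unit_sphere[OF U])
  fix z assume "NX z = 1"
  have zero: "0 \<in> U"
    by (rule Y.subspace_0[OF U])
  have "(INF y\<in>U. NY (T z - y)) \<le> deviation U"
    unfolding deviation_def
    by (rule cSUP_upper[OF _ bdd_above_distances[OF zero]]) (simp add: \<open>NX z = 1\<close>)
  with r have "(INF y\<in>U. NY (T z - y)) < r"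
    by simp
  then show "\<exists>y\<in>U. NY (T z - y) \<le> r"
    using zero by (subst (asm) cINF_less_iff[OF _ bdd_below_distances]) (auto intro: less_imp_le)
qed

lemma kolmogorov_number_deviation:
  "kolm n = (INF U\<in>{U. Y.subspace U \<and> Y.edim U < enat n}. deviation U)"
  unfolding kolmogorov_number_def deviation_def ..

lemma bdd_below_deviations:
  "bdd_below (deviation ` {U. Y.subspace U \<and> Y.edim U < enat n})"
  by (rule bdd_belowI2[of _ 0]) (auto intro: deviation_nonneg Y.subspace_0)

lemma zero_subspace_admissible:
  assumes "n \<ge> 1"
  shows "{0} \<in> {U. Y.subspace U \<and> Y.edim U < enat n}"
proof -
  have "Y.edim {0} < enat n"
    unfolding Y.edim_less_iff using assms by (intro exI[of _ "{}"]) simp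
  then show ?thesis
    by (simp add: Y.subspace_single_0)
qed

lemma admissible_nonempty: "n \<ge> 1 \<Longrightarrow> {U. Y.subspace U \<and> Y.edim U < enat n} \<noteq> {}"
  using zero_subspace_admissible by blast

lemma kolmogorov_number_nonneg:
  assumes "n \<ge> 1"
  shows "0 \<le> kolm n"
  unfolding kolmogorov_number_deviation
  by (rule cINF_greatest[OF admissible_nonempty[OF assms]])
    (auto intro: deviation_nonneg Y.subspace_0)

lemma kolmogorov_number_le:
  assumes B: "finite B" "card B < n" and approx: "approximable (Y.span B) r" and r: "0 \<le> r"
  shows "kolm n \<le> r"
proof -
  have "Y.edim (Y.span B) < enat n"
    unfolding Y.edim_less_iff using B by blast
  then have "kolm n \<le> deviation (Y.span B)"
    unfolding kolmogorov_number_deviation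
    by (intro cINF_lower[OF bdd_below_deviations]) (simp add: Y.subspace_span)
  also have "\<dots> \<le> r"
    by (rule deviation_le[OF approx r])
  finally show ?thesis .
qed

lemma approximable_mono: "approximable U r \<Longrightarrow> U \<subseteq> V \<Longrightarrow> approximable V r"
  unfolding approximable_def by blast

lemma kolmogorov_number_lessE:
  assumes n: "n \<ge> 1" and r: "kolm n < r"
  obtains B where "finite B" "card B < n" "approximable (Y.span B) r"
proof -
  have "\<exists>U\<in>{U. Y.subspace U \<and> Y.edim U < enat n}. deviation U < r"
    using r unfolding kolmogorov_number_deviation
    by (subst (asm) cINF_less_iff[OF admissible_nonempty[OF n] bdd_below_deviations])
  then obtain U where U: "Y.subspace U" "Y.edim U < enat n" "deviation U < r"
    by blast
  obtain B where B: "finite B" "card B < n" "U \<subseteq> Y.span B"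
    using U(2) unfolding Y.edim_less_iff by blast
  show thesis
    by (rule that[OF B(1,2) approximable_mono[OF approximable_if_deviation_less[OF U(1,3)] B(3)]])
qed

lemma kolmogorov_number_mono:
  assumes "1 \<le> m" "m \<le> n"
  shows "kolm n \<le> kolm m"
  unfolding kolmogorov_number_deviation
proof (rule cINF_superset_mono[OF admissible_nonempty[OF assms(1)]])
  show "{U. Y.subspace U \<and> Y.edim U < enat m} \<subseteq> {U. Y.subspace U \<and> Y.edim U < enat n}"
    using assms(2) by (auto intro: less_le_trans)
qed (auto simp: bdd_below_deviations)

section \<open>Norm, rank, sums, products and the identity\<close>

lemma operator_norm_eq: "operator_norm NX NY T = kolm 1"
proof -
  have "U = {0}" if "U \<in> {U. Y.subspace U \<and> Y.edim U < enat 1}" for U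
    using that Y.subspace_0[of U] unfolding Y.edim_less_iff by auto
  then have "{U. Y.subspace U \<and> Y.edim U < enat 1} = {{0}}"
    using zero_subspace_admissible[of 1] by blast
  then show ?thesis
    unfolding kolmogorov_number_deviation by (simp add: deviation_def operator_norm_def)
qed

lemma kolmogorov_number_eq_0_if_rank_less:
  assumes "operator_rank sY T < enat n"
  shows "kolm n = 0"
proof (rule antisym)
  obtain B where B: "finite B" "card B < n" "range T \<subseteq> Y.span B"
    using assms unfolding operator_rank_def Y.edim_less_iff by blast
  have "approximable (Y.span B) 0"
    unfolding approximable_def
  proof
    fix x
    show "\<exists>y\<in>Y.span B. NY (T x - y) \<le> 0 * NX x"
      using B(3) by (intro bexI[of _ "T x"]) auto
  qed
  then show "kolm n \<le> 0"
    by (rule kolmogorov_number_le[OF B(1,2)]) simp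
  show "0 \<le> kolm n"
    using B(2) by (intro kolmogorov_number_nonneg) simp
qed

end

text \<open>
  The condition on \<open>q\<close> abstracts from the kind of triangle inequality. For a quasi-norm it holds with
  \<open>q = C * (r + s)\<close>, for a \<open>\<rho>\<close>-norm with \<open>q = (r\<^sup>\<rho> + s\<^sup>\<rho>)\<^bsup>1/\<rho>\<^esup>\<close>.
\<close>

lemma kolmogorov_number_add:
  assumes S: "bounded_operator sX NX sY NY S" and T: "bounded_operator sX NX sY NY T"
    and ST: "bounded_operator sX NX sY NY (\<lambda>x. S x + T x)"
    and m: "m \<ge> 1" and n: "n \<ge> 1"
    and r: "kolmogorov_number NX sY NY m S < r" and s: "kolmogorov_number NX sY NY n T < s"
    and q: "0 \<le> q"
    and triangle: "\<And>y z t. 0 \<le> t \<Longrightarrow> NY y \<le> r * t \<Longrightarrow> NY z \<le> s * t \<Longrightarrow> NY (y + z) \<le> q * t"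
  shows "kolmogorov_number NX sY NY (m + n - 1) (\<lambda>x. S x + T x) \<le> q"
proof -
  interpret S: bounded_operator sX NX sY NY S by fact
  interpret T: bounded_operator sX NX sY NY T by fact
  interpret ST: bounded_operator sX NX sY NY "\<lambda>x. S x + T x" by fact
  obtain A where A: "finite A" "card A < m" "S.approximable (S.Y.span A) r"
    by (rule S.kolmogorov_number_lessE[OF m r])
  obtain B where B: "finite B" "card B < n" "T.approximable (S.Y.span B) s"
    by (rule T.kolmogorov_number_lessE[OF n s])
  have "ST.approximable (S.Y.span (A \<union> B)) q"
    unfolding ST.approximable_def
  proof
    fix x
    obtain u where u: "u \<in> S.Y.span A" "NY (S x - u) \<le> r * NX x"
      using A(3) unfolding S.approximable_def by blast
    obtain v where v: "v \<in> S.Y.span B" "NY (T x - v) \<le> s * NX x"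
      using B(3) unfolding T.approximable_def by blast
    have "NY (S x + T x - (u + v)) \<le> q * NX x"
      using triangle[OF S.X.nonneg u(2) v(2)] by (simp add: algebra_simps)
    moreover have "u + v \<in> S.Y.span (A \<union> B)"
      using u(1) v(1) S.Y.span_mono[of A "A \<union> B"] S.Y.span_mono[of B "A \<union> B"]
      by (intro S.Y.span_add) auto
    ultimately show "\<exists>y\<in>S.Y.span (A \<union> B). NY (S x + T x - y) \<le> q * NX x"
      by blast
  qed
  moreover have "card (A \<union> B) < m + n - 1"
    using card_Un_le[of A B] A(2) B(2) by linarith
  ultimately show ?thesis
    using A(1) B(1) q by (intro ST.kolmogorov_number_le[of "A \<union> B"]) auto
qed

text \<open>
  If \<open>v\<close> approximates \<open>T x\<close> and \<open>u\<close> approximates \<open>S (T x - v)\<close>, then \<open>u + S v\<close> approximates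
  \<open>S (T x)\<close> with the product of the two relative errors. The vectors \<open>u + S v\<close> lie in the span of
  \<open>A \<union> S ` B\<close>.
\<close>

lemma kolmogorov_number_compose:
  assumes S: "bounded_operator sY NY sW NW S" and T: "bounded_operator sX NX sY NY T"
    and ST: "bounded_operator sX NX sW NW (S \<circ> T)"
    and m: "m \<ge> 1" and n: "n \<ge> 1"
    and r: "kolmogorov_number NY sW NW m S < r" and s: "kolmogorov_number NX sY NY n T < s"
  shows "kolmogorov_number NX sW NW (m + n - 1) (S \<circ> T) \<le> r * s"
proof -
  interpret S: bounded_operator sY NY sW NW S by fact
  interpret T: bounded_operator sX NX sY NY T by fact
  interpret ST: bounded_operator sX NX sW NW "S \<circ> T" by fact
  interpret lin: Vector_Spaces.linear sY sW S by (rule S.linear_T)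
  have r0: "0 \<le> r" and s0: "0 \<le> s"
    using S.kolmogorov_number_nonneg[OF m] T.kolmogorov_number_nonneg[OF n] r s by auto
  obtain A where A: "finite A" "card A < m" "S.approximable (S.Y.span A) r"
    by (rule S.kolmogorov_number_lessE[OF m r])
  obtain B where B: "finite B" "card B < n" "T.approximable (S.X.span B) s"
    by (rule T.kolmogorov_number_lessE[OF n s])
  have "ST.approximable (S.Y.span (A \<union> S ` B)) (r * s)"
    unfolding ST.approximable_def
  proof
    fix x
    obtain v where v: "v \<in> S.X.span B" "NY (T x - v) \<le> s * NX x"
      using B(3) unfolding T.approximable_def by blast
    obtain u where u: "u \<in> S.Y.span A" "NW (S (T x - v) - u) \<le> r * NY (T x - v)"
      using A(3) unfolding S.approximable_def by blast
    have "NW ((S \<circ> T) x - (u + S v)) = NW (S (T x - v) - u)"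
      by (simp add: lin.diff algebra_simps)
    also have "\<dots> \<le> r * (s * NX x)"
      using u(2) mult_left_mono[OF v(2) r0] by (rule order_trans)
    finally have "NW ((S \<circ> T) x - (u + S v)) \<le> r * s * NX x"
      by (simp add: mult.assoc)
    moreover have "S v \<in> S.Y.span (S ` B)"
      using v(1) by (simp add: lin.span_image)
    then have "u + S v \<in> S.Y.span (A \<union> S ` B)"
      using u(1) S.Y.span_mono[of A "A \<union> S ` B"] S.Y.span_mono[of "S ` B" "A \<union> S ` B"]
      by (intro S.Y.span_add) auto
    ultimately show "\<exists>y\<in>S.Y.span (A \<union> S ` B). NW ((S \<circ> T) x - y) \<le> r * s * NX x"
      by blast
  qed
  moreover have "card (A \<union> S ` B) < m + n - 1"
    using card_Un_le[of A "S ` B"] card_image_le[OF B(1), of S] A(2) B(2) by linarith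
  ultimately show ?thesis
    using A(1) B(1) r0 s0 by (intro ST.kolmogorov_number_le[of "A \<union> S ` B"]) auto
qed

text \<open>
  If \<open>d\<^sub>n(id) < 1\<close>, some proper subspace, spanned by fewer than \<open>n\<close> vectors, approximates every \<open>x\<close>
  with relative error \<open>r < 1\<close>. Riesz's lemma excludes this.
\<close>

lemma (in quasi_norm_heine_borel_scalars) kolmogorov_number_id:
  assumes n: "n \<ge> 1" and dim: "enat n \<le> edim UNIV"
  shows "kolmogorov_number N scale N n id = 1"
proof -
  have "id \<in> bounded_operators scale N scale N"
    unfolding bounded_operators_def by (auto simp: linear_id intro!: exI[of _ 1])
  then interpret I: bounded_operator scale N scale N id
    by unfold_locales
  show ?thesis
  proof (rule antisym)
    show "I.kolm n \<le> 1"
      using n by (intro I.kolmogorov_number_le[of "{}"]) (auto simp: I.approximable_def)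
    show "1 \<le> I.kolm n"
    proof (rule ccontr)
      assume "\<not> 1 \<le> I.kolm n"
      then obtain r where r: "I.kolm n < r" "r < 1"
        using dense[of "I.kolm n" 1] by auto
      obtain B where B: "finite B" "card B < n" "I.approximable (span B) r"
        by (rule I.kolmogorov_number_lessE[OF n r(1)])
      have "\<not> edim UNIV < enat n"
        using dim by simp
      then have "span B \<noteq> UNIV"
        using B(1,2) unfolding edim_less_iff by blast
      then obtain x where "\<forall>y\<in>span B. r * N x < N (x - y)"
        using riesz_lemma[OF B(1) _ r(2)] by blast
      then show False
        using B(3) unfolding I.approximable_def by (force simp: not_less[symmetric])
    qed
  qed
qed

section \<open>Compact operators\<close>

lemma kolmogorov_number_tendsto_0:
  assumes op: "bounded_operator sX NX sY NY T" and Y: "quasi_norm sY NY CY"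
    and tb: "quasi_norm.totally_bounded_set NY (T ` {x. NX x \<le> 1})"
  shows "(\<lambda>n. kolmogorov_number NX sY NY n T) \<longlonglongrightarrow> 0"
proof (rule LIMSEQ_I)
  interpret bounded_operator sX NX sY NY T by fact
  interpret Y: quasi_norm sY NY CY by fact
  fix e :: real assume e: "0 < e"
  then have "\<exists>F. finite F \<and> (\<forall>z\<in>T ` {x. NX x \<le> 1}. \<exists>c\<in>F. NY (z - c) < e / 2)"
    using tb half_gt_zero unfolding Y.totally_bounded_set_def by blast
  then obtain F where F: "finite F" "\<And>x. NX x \<le> 1 \<Longrightarrow> \<exists>c\<in>F. NY (T x - c) < e / 2"
    by blast
  have "\<exists>y\<in>Y.span F. NY (T z - y) \<le> e / 2" if "NX z = 1" for z
    using F(2)[of z] that Y.span_base[of _ F] by (auto intro: less_imp_le)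
  then have "approximable (Y.span F) (e / 2)"
    by (rule approximable_if_unit_sphere[OF Y.subspace_span])
  \<comment> \<open>The dimension must be strictly smaller than the index, hence the successor.\<close>
  then have small: "kolm (card F + 1) \<le> e / 2"
    using F(1) e by (intro kolmogorov_number_le[of F]) auto
  have "norm (kolm n - 0) < e" if "n \<ge> card F + 1" for n
    using kolmogorov_number_mono[of "card F + 1" n] kolmogorov_number_nonneg[of n] small that e
    by simp
  then show "\<exists>n0. \<forall>n\<ge>n0. norm (kolm n - 0) < e"
    by blast
qed

text \<open>
  Choose a finite-dimensional subspace that approximates the image of \<open>A\<close> up to \<open>d\<close>. The approximants
  form a bounded set, and a \<open>d\<close>-net for them is an \<open>e\<close>-net for \<open>T ` A\<close> when \<open>2 * C * d < e\<close>.
\<close>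

lemma totally_bounded_image:
  assumes op: "bounded_operator sX NX sY NY T" and Y: "quasi_norm_heine_borel_scalars sY NY CY"
    and lim: "(\<lambda>n. kolmogorov_number NX sY NY n T) \<longlonglongrightarrow> 0"
    and A: "\<And>x. x \<in> A \<Longrightarrow> NX x \<le> M"
  shows "quasi_norm.totally_bounded_set NY (T ` A)"
proof -
  interpret bounded_operator sX NX sY NY T by fact
  interpret Y: quasi_norm_heine_borel_scalars sY NY CY by fact
  show ?thesis
    unfolding Y.totally_bounded_set_def
  proof (intro allI impI)
    fix e :: real assume e: "0 < e"
    define d where "d = e / (4 * CY)"
    define R where "R = max M 1"
    have d: "d > 0" and R: "R > 0"
      using e Y.const_pos by (auto simp: d_def R_def)
    have AR: "NX x \<le> R" if "x \<in> A" for x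
      using A[OF that] by (simp add: R_def)
    obtain K where K: "0 \<le> K" "\<And>x. NY (T x) \<le> K * NX x"
      using bound by blast
    have "\<forall>\<^sub>F n in sequentially. kolm n < d / R"
      using lim d R by (intro order_tendstoD) auto
    then have "\<forall>\<^sub>F n in sequentially. n \<ge> 1 \<and> kolm n < d / R"
      using eventually_ge_at_top by (rule eventually_conj[rotated])
    then obtain n where n: "n \<ge> 1" "kolm n < d / R"
      using eventually_happens by fastforce
    obtain B where B: "finite B" "card B < n" "approximable (Y.span B) (d / R)"
      by (rule kolmogorov_number_lessE[OF n])
    have near: "\<exists>y\<in>Y.span B. NY (T x - y) \<le> d" if "x \<in> A" for x
    proof -
      obtain y where y: "y \<in> Y.span B" "NY (T x - y) \<le> d / R * NX x"
        using B(3) unfolding approximable_def by blast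
      have "d / R * NX x \<le> d / R * R"
        using AR[OF that] d R by (intro mult_left_mono) auto
      then have "NY (T x - y) \<le> d"
        using y(2) R by simp
      then show ?thesis
        using y(1) by blast
    qed
    define D where "D = {y \<in> Y.span B. NY y \<le> CY * (d + K * R)}"
    have "Y.totally_bounded_set D"
      by (rule Y.bounded_subset_span_totally_bounded[OF B(1)]) (auto simp: D_def)
    then obtain F where F: "finite F" "\<forall>y\<in>D. \<exists>c\<in>F. NY (y - c) < d"
      using d unfolding Y.totally_bounded_set_def by blast
    have "\<exists>c\<in>F. NY (T x - c) < e" if x: "x \<in> A" for x
    proof -
      obtain y where y: "y \<in> Y.span B" "NY (T x - y) \<le> d"
        using near[OF x] by blast
      have "NY (T x) \<le> K * R"
        using K(2)[of x] mult_left_mono[OF AR[OF x] K(1)] by simp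
      then have "NY (y - 0) \<le> CY * (d + K * R)"
        using y(2) Y.N_diff_commute[of "T x" y] by (intro Y.N_diff_bound[where z = "T x"]) auto
      then have "y \<in> D"
        using y(1) by (simp add: D_def)
      then obtain c where c: "c \<in> F" "NY (y - c) < d"
        using F(2) by blast
      have "NY (T x - c) \<le> CY * (d + d)"
        using y(2) c(2) by (intro Y.N_diff_bound[where z = y]) auto
      also have "\<dots> < e"
        using e Y.const_pos by (simp add: d_def field_simps)
      finally show ?thesis
        using c(1) by blast
    qed
    then show "\<exists>F. finite F \<and> (\<forall>z\<in>T ` A. \<exists>c\<in>F. NY (z - c) < e)"
      using F(1) by blast
  qed
qed

lemma compact_operator_iff:
  fixes sY :: "'k::{real_normed_field,heine_borel} \<Rightarrow> 'y::ab_group_add \<Rightarrow> 'y"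
  assumes op: "bounded_operator sX NX sY NY T" and Y: "quasi_banach sY NY CY"
  shows "compact_operator NX NY T \<longleftrightarrow> (\<lambda>n. kolmogorov_number NX sY NY n T) \<longlonglongrightarrow> 0"
proof
  interpret Y: quasi_banach sY NY CY by fact
  interpret YL: quasi_norm_heine_borel_scalars sY NY CY ..
  show "(\<lambda>n. kolmogorov_number NX sY NY n T) \<longlonglongrightarrow> 0" if "compact_operator NX NY T"
    using Y.compact_operator_imp_totally_bounded[OF that, of "{x. NX x \<le> 1}" 1]
    by (intro kolmogorov_number_tendsto_0[OF op Y.quasi_norm_axioms]) simp
  show "compact_operator NX NY T" if "(\<lambda>n. kolmogorov_number NX sY NY n T) \<longlonglongrightarrow> 0"
    unfolding compact_operator_def
  proof (intro allI impI)
    fix A assume "\<exists>M. \<forall>x\<in>A. NX x \<le> M"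
    then obtain M where "\<And>x. x \<in> A \<Longrightarrow> NX x \<le> M"
      by blast
    then show "compactin (norm_topology NY) (norm_topology NY closure_of (T ` A))"
      by (intro Y.totally_bounded_closure_compact
          totally_bounded_image[OF op YL.quasi_norm_heine_borel_scalars_axioms that])
  qed
qed

section \<open>Inequalities between Kolmogorov numbers\<close>

lemma bounded_operators_add:
  assumes Y: "quasi_norm sY NY CY"
    and S: "bounded_operator sX NX sY NY S" and T: "bounded_operator sX NX sY NY T"
  shows "(\<lambda>x. S x + T x) \<in> bounded_operators sX NX sY NY"
proof -
  interpret Y: quasi_norm sY NY CY by fact
  interpret S: bounded_operator sX NX sY NY S by fact
  interpret T: bounded_operator sX NX sY NY T by fact
  obtain K where K: "\<And>x. NY (S x) \<le> K * NX x"
    using S.bound by blast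
  obtain L where L: "\<And>x. NY (T x) \<le> L * NX x"
    using T.bound by blast
  have "NY (S x + T x) \<le> CY * (K + L) * NX x" for x
    using Y.N_add_bound[OF K L] by (simp add: algebra_simps)
  moreover have "Vector_Spaces.linear sX sY (\<lambda>x. S x + T x)"
    using S.linear_T T.linear_T unfolding Vector_Spaces.linear_iff
    by (simp add: Y.scale_right_distrib algebra_simps)
  ultimately show ?thesis
    unfolding bounded_operators_def by blast
qed

lemma bounded_operators_compose:
  assumes S: "bounded_operator sY NY sW NW S" and T: "bounded_operator sX NX sY NY T"
  shows "S \<circ> T \<in> bounded_operators sX NX sW NW"
proof -
  interpret S: bounded_operator sY NY sW NW S by fact
  interpret T: bounded_operator sX NX sY NY T by fact
  obtain K where K: "0 \<le> K" "\<And>x. NW (S x) \<le> K * NY x"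
    using S.bound by blast
  obtain L where L: "\<And>x. NY (T x) \<le> L * NX x"
    using T.bound by blast
  have "NW ((S \<circ> T) x) \<le> K * L * NX x" for x
    using K(2)[of "T x"] mult_left_mono[OF L[of x] K(1)] by (simp add: mult.assoc)
  moreover have "Vector_Spaces.linear sX sW (S \<circ> T)"
    using T.linear_T S.linear_T by (rule Vector_Spaces.linear_compose)
  ultimately show ?thesis
    unfolding bounded_operators_def by blast
qed

lemma bounded_operators_equivalent_norm:
  assumes T: "bounded_operator sX NX sY NY T" and equiv: "equivalent_norms NY NY'"
  shows "T \<in> bounded_operators sX NX sY NY'"
proof -
  interpret T: bounded_operator sX NX sY NY T by fact
  obtain K where K: "\<And>x. NY (T x) \<le> K * NX x"
    using T.bound by blast
  obtain c where c: "\<And>y. NY' y \<le> c * NY y"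
    using equiv unfolding equivalent_norms_def by blast
  have "NY' (T x) \<le> \<bar>c\<bar> * K * NX x" for x
  proof -
    have "NY' (T x) \<le> \<bar>c\<bar> * NY (T x)"
      using c[of "T x"] mult_right_mono[OF abs_ge_self T.Y.nonneg, of c "T x"] by linarith
    also have "\<dots> \<le> \<bar>c\<bar> * (K * NX x)"
      by (rule mult_left_mono[OF K]) simp
    finally show ?thesis
      by (simp add: mult.assoc)
  qed
  then show ?thesis
    using T.linear_T unfolding bounded_operators_def by blast
qed

text \<open>
  The approximation results hold for all \<open>r\<close> and \<open>s\<close> strictly above the Kolmogorov numbers. This
  lemma passes to the limit from the right.
\<close>

lemma le_if_le_right_limits:
  fixes g :: "real \<Rightarrow> real \<Rightarrow> real"
  assumes le: "\<And>r s. a < r \<Longrightarrow> b < s \<Longrightarrow> k \<le> g r s"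
    and lim: "(\<lambda>n. g (a + inverse (real (Suc n))) (b + inverse (real (Suc n)))) \<longlonglongrightarrow> g a b"
  shows "k \<le> g a b"
  using lim by (rule LIMSEQ_le_const) (auto intro!: le)

lemma kolmogorov_number_add_quasi_norm:
  assumes Y: "quasi_norm sY NY CY"
    and S: "bounded_operator sX NX sY NY S" and T: "bounded_operator sX NX sY NY T"
    and m: "m \<ge> 1" and n: "n \<ge> 1"
  shows "kolmogorov_number NX sY NY (m + n - 1) (\<lambda>x. S x + T x)
    \<le> CY * (kolmogorov_number NX sY NY m S + kolmogorov_number NX sY NY n T)"
proof -
  interpret Y: quasi_norm sY NY CY by fact
  interpret S: bounded_operator sX NX sY NY S by fact
  interpret T: bounded_operator sX NX sY NY T by fact
  interpret ST: bounded_operator sX NX sY NY "\<lambda>x. S x + T x"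
    by unfold_locales (rule bounded_operators_add[OF Y S T])
  show ?thesis
  proof (rule le_if_le_right_limits[where g = "\<lambda>r s. CY * (r + s)"])
    fix r s assume r: "S.kolm m < r" and s: "T.kolm n < s"
    have "0 \<le> r" "0 \<le> s"
      using r s S.kolmogorov_number_nonneg[OF m] T.kolmogorov_number_nonneg[OF n] by auto
    then show "ST.kolm (m + n - 1) \<le> CY * (r + s)"
    proof (intro kolmogorov_number_add[OF S T ST.bounded_operator_axioms m n r s])
      show "NY (y + z) \<le> CY * (r + s) * t" if "NY y \<le> r * t" "NY z \<le> s * t" for y z t
        using Y.N_add_bound[OF that] by (simp add: algebra_simps)
    qed (use Y.const_pos in simp)
  qed (intro tendsto_intros LIMSEQ_inverse_real_of_nat_add)
qed

lemma kolmogorov_number_add_rho_norm: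
  assumes Y: "rho_norm sY NY rho"
    and S: "bounded_operator sX NX sY NY S" and T: "bounded_operator sX NX sY NY T"
    and ST: "bounded_operator sX NX sY NY (\<lambda>x. S x + T x)"
    and m: "m \<ge> 1" and n: "n \<ge> 1"
  shows "kolmogorov_number NX sY NY (m + n - 1) (\<lambda>x. S x + T x) powr rho
    \<le> kolmogorov_number NX sY NY m S powr rho + kolmogorov_number NX sY NY n T powr rho"
proof -
  interpret Y: rho_norm sY NY rho by fact
  interpret S: bounded_operator sX NX sY NY S by fact
  interpret T: bounded_operator sX NX sY NY T by fact
  interpret ST: bounded_operator sX NX sY NY "\<lambda>x. S x + T x" by fact
  note rho = Y.rho_pos
  have mn: "1 \<le> m + n - 1"
    using m n by simp
  show ?thesis
  proof (rule le_if_le_right_limits[where g = "\<lambda>r s. r powr rho + s powr rho"])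
    fix r s assume r: "S.kolm m < r" and s: "T.kolm n < s"
    have r0: "0 \<le> r" and s0: "0 \<le> s"
      using r s S.kolmogorov_number_nonneg[OF m] T.kolmogorov_number_nonneg[OF n] by auto
    define q where "q = (r powr rho + s powr rho) powr (1 / rho)"
    have q: "0 \<le> q" "q powr rho = r powr rho + s powr rho"
      using rho by (auto simp: q_def powr_powr)
    have "ST.kolm (m + n - 1) \<le> q"
    proof (rule kolmogorov_number_add[OF S T ST m n r s q(1)])
      fix y z t assume t: "0 \<le> t" and y: "NY y \<le> r * t" and z: "NY z \<le> s * t"
      have "NY (y + z) powr rho \<le> NY y powr rho + NY z powr rho"
        by (rule Y.rho_triangle)
      also have "\<dots> \<le> (r * t) powr rho + (s * t) powr rho"
        using y z rho by (intro add_mono powr_mono2) (auto simp: Y.nonneg)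
      also have "\<dots> = (q * t) powr rho"
        using r0 s0 t q by (simp add: powr_mult distrib_right)
      finally show "NY (y + z) \<le> q * t"
        using rho q(1) t Y.nonneg[of "y + z"] powr_less_mono2[of rho "q * t" "NY (y + z)"]
        by (meson mult_nonneg_nonneg not_less)
    qed
    then have "ST.kolm (m + n - 1) powr rho \<le> q powr rho"
      using rho ST.kolmogorov_number_nonneg[OF mn] by (intro powr_mono2) auto
    then show "ST.kolm (m + n - 1) powr rho \<le> r powr rho + s powr rho"
      by (simp add: q(2))
  next
    show "(\<lambda>i. (S.kolm m + inverse (real (Suc i))) powr rho
        + (T.kolm n + inverse (real (Suc i))) powr rho)
      \<longlonglongrightarrow> S.kolm m powr rho + T.kolm n powr rho"
      using rho S.kolmogorov_number_nonneg[OF m] T.kolmogorov_number_nonneg[OF n]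
      by (intro tendsto_add tendsto_powr2 LIMSEQ_inverse_real_of_nat_add tendsto_const) auto
  qed
qed

lemma kolmogorov_number_compose_le:
  assumes S: "bounded_operator sY NY sW NW S" and T: "bounded_operator sX NX sY NY T"
    and m: "m \<ge> 1" and n: "n \<ge> 1"
  shows "kolmogorov_number NX sW NW (m + n - 1) (S \<circ> T)
    \<le> kolmogorov_number NY sW NW m S * kolmogorov_number NX sY NY n T"
proof -
  interpret S: bounded_operator sY NY sW NW S by fact
  interpret T: bounded_operator sX NX sY NY T by fact
  interpret ST: bounded_operator sX NX sW NW "S \<circ> T"
    by unfold_locales (rule bounded_operators_compose[OF S T])
  show ?thesis
  proof (rule le_if_le_right_limits[where g = "\<lambda>r s. r * s"])
    show "ST.kolm (m + n - 1) \<le> r * s" if "S.kolm m < r" "T.kolm n < s" for r s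
      by (rule kolmogorov_number_compose[OF S T ST.bounded_operator_axioms m n that])
  qed (intro tendsto_mult LIMSEQ_inverse_real_of_nat_add)
qed

theorem theorem20:
  fixes sX :: "'k::{real_normed_field,heine_borel} \<Rightarrow> 'x::ab_group_add \<Rightarrow> 'x"
    and sY :: "'k \<Rightarrow> 'y::ab_group_add \<Rightarrow> 'y"
    and sW :: "'k \<Rightarrow> 'w::ab_group_add \<Rightarrow> 'w"
    and NX :: "'x \<Rightarrow> real" and NY :: "'y \<Rightarrow> real" and NW :: "'w \<Rightarrow> real"
    and CX CY CW :: real
    and T :: "'x \<Rightarrow> 'y"
  assumes X: "quasi_banach sX NX CX"
    and Y: "quasi_banach sY NY CY"
    and W: "quasi_banach sW NW CW"
    and T: "T \<in> bounded_operators sX NX sY NY"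
  shows
    \<comment> \<open>(M)\<close>
    "(operator_norm NX NY T = kolmogorov_number NX sY NY 1 T \<and>
      (\<forall>n\<ge>1. kolmogorov_number NX sY NY (n + 1) T \<le> kolmogorov_number NX sY NY n T) \<and>
      (\<forall>n\<ge>1. 0 \<le> kolmogorov_number NX sY NY n T)) \<and>
    \<comment> \<open>(A)\<close>
    (\<forall>S \<in> bounded_operators sX NX sY NY. \<forall>m\<ge>1. \<forall>n\<ge>1.
      kolmogorov_number NX sY NY (m + n - 1) (\<lambda>x. S x + T x)
        \<le> CY * (kolmogorov_number NX sY NY m S + kolmogorov_number NX sY NY n T)) \<and>
    (\<forall>NY' rho. rho_norm sY NY' rho \<longrightarrow> equivalent_norms NY NY' \<longrightarrow>
      (\<forall>S \<in> bounded_operators sX NX sY NY. \<forall>m\<ge>1. \<forall>n\<ge>1.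
        kolmogorov_number NX sY NY' (m + n - 1) (\<lambda>x. S x + T x) powr rho
          \<le> kolmogorov_number NX sY NY' m S powr rho + kolmogorov_number NX sY NY' n T powr rho)) \<and>
    \<comment> \<open>(P)\<close>
    (\<forall>S \<in> bounded_operators sY NY sW NW. \<forall>m\<ge>1. \<forall>n\<ge>1.
      kolmogorov_number NX sW NW (m + n - 1) (S \<circ> T)
        \<le> kolmogorov_number NY sW NW m S * kolmogorov_number NX sY NY n T) \<and>
    \<comment> \<open>(R)\<close>
    (\<forall>n\<ge>1. operator_rank sY T < enat n \<longrightarrow> kolmogorov_number NX sY NY n T = 0) \<and>
    \<comment> \<open>(N)\<close>
    (\<forall>n\<ge>1. enat n \<le> vector_space.edim sX UNIV \<longrightarrow>
      kolmogorov_number NX sX NX n (id :: 'x \<Rightarrow> 'x) = 1) \<and>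
    \<comment> \<open>(C)\<close>
    (compact_operator NX NY T \<longleftrightarrow> (\<lambda>n. kolmogorov_number NX sY NY n T) \<longlonglongrightarrow> 0)"
proof -
  interpret X: quasi_banach sX NX CX by fact
  interpret Y: quasi_banach sY NY CY by fact
  interpret W: quasi_banach sW NW CW by fact
  interpret XL: quasi_norm_heine_borel_scalars sX NX CX ..
  have XY: "bounded_operator sX NX sY NY S" if "S \<in> bounded_operators sX NX sY NY" for S
    using that by unfold_locales
  have YW: "bounded_operator sY NY sW NW S" if "S \<in> bounded_operators sY NY sW NW" for S
    using that by unfold_locales
  interpret T: bounded_operator sX NX sY NY T
    by (rule XY[OF T])
  have rho: "kolmogorov_number NX sY NY' (m + n - 1) (\<lambda>x. S x + T x) powr rho
      \<le> kolmogorov_number NX sY NY' m S powr rho + kolmogorov_number NX sY NY' n T powr rho"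
    if Y': "rho_norm sY NY' rho" and equiv: "equivalent_norms NY NY'"
      and S: "S \<in> bounded_operators sX NX sY NY" and m: "1 \<le> m" and n: "1 \<le> n"
    for NY' rho S m n
  proof -
    interpret Y': rho_norm sY NY' rho by fact
    have bounded': "bounded_operator sX NX sY NY' R" if "R \<in> bounded_operators sX NX sY NY" for R
      by unfold_locales (rule bounded_operators_equivalent_norm[OF XY[OF that] equiv])
    show ?thesis
      by (rule kolmogorov_number_add_rho_norm[OF Y' bounded'[OF S] bounded'[OF T]
          bounded'[OF bounded_operators_add[OF Y.quasi_norm_axioms XY[OF S] XY[OF T]]] m n])
  qed
  show ?thesis
    using T.operator_norm_eq T.kolmogorov_number_mono T.kolmogorov_number_nonneg
      kolmogorov_number_add_quasi_norm[OF Y.quasi_norm_axioms XY XY[OF T]] rho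
      kolmogorov_number_compose_le[OF YW XY[OF T]] T.kolmogorov_number_eq_0_if_rank_less
      XL.kolmogorov_number_id compact_operator_iff[OF XY[OF T] Y]
    by (intro conjI allI ballI impI) auto
qed

end
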